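(* Each Casimir element of the Racah algebra $\Re$ is algebraically independent over $\mathfrak C$.
   Context: $\mathbb F$ is a field with $\operatorname{char}\mathbb F\neq 2$. All algebras are unital and associative, and a subalgebra has the same unit as the parent algebra. Write $[x,y]=xy-yx$ and $\{x,y\}=xy+yx$. The Racah algebra $\Re$ is the $\mathbb F$-algebra defined by generators $A,B,C,D$ and the relations $[A,B]=[B,C]=[C,A]=2D$ together with the relations asserting that each of the elements $$\alpha=[A,D]+AC-BA,\qquad \beta=[B,D]+BA-CB,\qquad \gamma=[C,D]+CB-AC$$ is central in $\Re$. Set $\delta=A+B+C$. Let $\mathfrak C$ denote the $\mathbb F$-subalgebra of $\Re$ generated by $\alpha,\beta,\gamma,\delta$ (it is commutative and contained in the center of $\Re$). The Casimir class of $\Re$ is the coset $$D^2+A^2+B^2+\frac{(\delta+2)\{A,B\}-\{A^2,B\}-\{A,B^2\}}{2}+A(\beta-\delta)-B(\delta+\alpha)+\mathfrak C$$ of $\mathfrak C$ in $\Re$; each element of this coset is called a Casimir element of $\Re$. An element $\Omega\in\Re$ is algebraically independent over $\mathfrak C$ if $p(\Omega)\neq 0$ for every nonzero polynomial $p\in\mathfrak C[x]$ in one variable. *)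

theory Defs
  imports "HOL-Library.Poly_Mapping" "HOL-Computational_Algebra.Polynomial"
begin

section \<open>Free unital associative algebras\<close>

text \<open>
  The free monoid is written additively because the convolution product on
  \<open>\<Rightarrow>\<^sub>0\<close> asks for exponents in \<^class>\<open>monoid_add\<close>; the wrapper around
  \<open>list\<close> avoids a global instance on lists. The free algebra over \<open>'f\<close> on the
  letters \<open>'g\<close> is the monoid algebra \<open>'g word \<Rightarrow>\<^sub>0 'f\<close>.
\<close>

datatype 'g word = Word (letters: "'g list")

instantiation word :: (type) monoid_add
begin

definition zero_word :: "'a word" where
  "zero_word = Word []"

definition plus_word :: "'a word \<Rightarrow> 'a word \<Rightarrow> 'a word" where
  "plus_word u v = Word (letters u @ letters v)"

instance
  by standard (simp_all add: zero_word_def plus_word_def)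

end

lemma word_add_eq_0_iff: "u + v = 0 \<longleftrightarrow> u = 0 \<and> v = (0 :: 'g word)"
  by (cases u; cases v) (simp add: zero_word_def plus_word_def)

type_synonym ('g, 'f) free_algebra = "'g word \<Rightarrow>\<^sub>0 'f"

definition free_gen :: "'g \<Rightarrow> ('g, 'f::field) free_algebra" where
  "free_gen g = Poly_Mapping.single (Word [g]) 1"

definition free_scale :: "'f \<Rightarrow> ('g, 'f::field) free_algebra \<Rightarrow> ('g, 'f) free_algebra" where
  "free_scale c = Poly_Mapping.map ((*) c)"

lemma free_scale_conv_mult: "free_scale c x = Poly_Mapping.single 0 c * x"
  by (simp add: free_scale_def mult_map_scale_conv_mult)

lemma free_algebra_induct [case_names single sum]:
  fixes x :: "('g, 'f::field) free_algebra"
  assumes single: "\<And>k v. P (Poly_Mapping.single k v)"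
    and sum: "\<And>p k v. P p \<Longrightarrow> P (Poly_Mapping.single k v) \<Longrightarrow> P (p + Poly_Mapping.single k v)"
  shows "P x"
proof (induction x rule: update_induct)
  case const
  show ?case using single[of 0 0] by simp
next
  case (update p k v)
  have "Poly_Mapping.update k v p = p + Poly_Mapping.single k v"
    using update(1)
    by (intro poly_mapping_eqI)
      (auto simp: lookup_update lookup_add lookup_single when_def in_keys_iff)
  then show ?case using sum[OF update(3) single] by simp
qed

lemma single_0_commute:
  fixes x :: "('g, 'f::field) free_algebra"
  shows "Poly_Mapping.single 0 c * x = x * Poly_Mapping.single 0 c"
proof (induction x rule: free_algebra_induct)
  case (single k v)
  then show ?case by (simp add: mult_single mult.commute)
next
  case (sum p k v)
  then show ?case by (simp add: distrib_left distrib_right)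
qed

lemma lookup_0_mult:
  fixes x y :: "('g, 'f::field) free_algebra"
  shows "Poly_Mapping.lookup (x * y) 0 = Poly_Mapping.lookup x 0 * Poly_Mapping.lookup y 0"
proof (induction x rule: free_algebra_induct)
  case (single k v)
  show ?case
  proof (induction y rule: free_algebra_induct)
    case (single l w)
    then show ?case by (simp add: mult_single lookup_single word_add_eq_0_iff when_def)
  next
    case (sum p k v)
    then show ?case by (simp add: distrib_left lookup_add)
  qed
next
  case (sum p k v)
  then show ?case by (simp add: distrib_right lookup_add)
qed


section \<open>Ring-theoretic notions\<close>

definition commutator :: "'r::ring \<Rightarrow> 'r \<Rightarrow> 'r" where
  "commutator x y = x * y - y * x"

definition anticommutator :: "'r::ring \<Rightarrow> 'r \<Rightarrow> 'r" where
  "anticommutator x y = x * y + y * x"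

definition two_sided_ideal :: "'r::ring_1 set \<Rightarrow> bool" where
  "two_sided_ideal I \<longleftrightarrow> 0 \<in> I \<and> (\<forall>x\<in>I. \<forall>y\<in>I. x + y \<in> I) \<and>
     (\<forall>x\<in>I. \<forall>r. r * x \<in> I \<and> x * r \<in> I)"

lemma two_sided_ideal_hull: "two_sided_ideal (two_sided_ideal hull S)"
  by (rule hull_in) (auto simp: two_sided_ideal_def)

lemma
  assumes "two_sided_ideal I"
  shows two_sided_ideal_zero: "0 \<in> I"
    and two_sided_ideal_add: "x \<in> I \<Longrightarrow> y \<in> I \<Longrightarrow> x + y \<in> I"
    and two_sided_ideal_mult_left: "x \<in> I \<Longrightarrow> r * x \<in> I"
    and two_sided_ideal_mult_right: "x \<in> I \<Longrightarrow> x * r \<in> I"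
    and two_sided_ideal_uminus: "x \<in> I \<Longrightarrow> - x \<in> I"
    and two_sided_ideal_diff: "x \<in> I \<Longrightarrow> y \<in> I \<Longrightarrow> x - y \<in> I"
proof -
  show *: "0 \<in> I" "x \<in> I \<Longrightarrow> y \<in> I \<Longrightarrow> x + y \<in> I" "x \<in> I \<Longrightarrow> r * x \<in> I" "x \<in> I \<Longrightarrow> x * r \<in> I"
    for x y r
    using assms by (auto simp: two_sided_ideal_def)
  show **: "- x \<in> I" if "x \<in> I" for x
    using *(3)[OF that, of "-1"] by simp
  show "x \<in> I \<Longrightarrow> y \<in> I \<Longrightarrow> x - y \<in> I"
    using *(2)[of x "- y"] **[of y] by simp
qed


section \<open>The Racah algebra\<close>

datatype racah_gen = Gen_A | Gen_B | Gen_C | Gen_D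

text \<open>
  The last three families say that the lifts of \<open>\<alpha>\<close>, \<open>\<beta>\<close>, \<open>\<gamma>\<close> commute with every
  element of the free algebra, i.e.\ become central in the quotient.
\<close>

definition racah_relators :: "(racah_gen, 'f::field) free_algebra set" where
  "racah_relators =
    (let A = free_gen Gen_A; B = free_gen Gen_B; C = free_gen Gen_C; D = free_gen Gen_D in
      {commutator A B - 2 * D, commutator B C - 2 * D, commutator C A - 2 * D} \<union>
      {commutator (commutator A D + A * C - B * A) x | x. True} \<union>
      {commutator (commutator B D + B * A - C * B) x | x. True} \<union>
      {commutator (commutator C D + C * B - A * C) x | x. True})"

definition racah_ideal :: "(racah_gen, 'f::field) free_algebra set" where
  "racah_ideal = two_sided_ideal hull racah_relators"

lemma two_sided_ideal_racah_ideal: "two_sided_ideal racah_ideal"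
  unfolding racah_ideal_def by (rule two_sided_ideal_hull)

lemmas racah_ideal_intros =
  two_sided_ideal_zero[OF two_sided_ideal_racah_ideal]
  two_sided_ideal_add[OF two_sided_ideal_racah_ideal]
  two_sided_ideal_mult_left[OF two_sided_ideal_racah_ideal]
  two_sided_ideal_mult_right[OF two_sided_ideal_racah_ideal]
  two_sided_ideal_uminus[OF two_sided_ideal_racah_ideal]
  two_sided_ideal_diff[OF two_sided_ideal_racah_ideal]

lemma racah_relators_subset: "racah_relators \<subseteq> racah_ideal"
  unfolding racah_ideal_def by (rule hull_subset)

lemma racah_ideal_lookup_0:
  assumes "x \<in> (racah_ideal :: (racah_gen, 'f::field) free_algebra set)"
  shows "Poly_Mapping.lookup x 0 = 0"
proof -
  let ?I = "{x :: (racah_gen, 'f) free_algebra. Poly_Mapping.lookup x 0 = 0}"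
  have gen: "Poly_Mapping.lookup (free_gen g) 0 = (0 :: 'f)" for g :: racah_gen
    by (simp add: free_gen_def lookup_single zero_word_def when_def)
  have comm: "Poly_Mapping.lookup (commutator x y) 0 = 0"
    for x y :: "(racah_gen, 'f) free_algebra"
    by (simp add: commutator_def lookup_minus lookup_0_mult)
  have "two_sided_ideal ?I"
    by (simp add: two_sided_ideal_def lookup_add lookup_0_mult)
  moreover have "racah_relators \<subseteq> ?I"
    by (auto simp: racah_relators_def Let_def comm lookup_minus lookup_0_mult gen)
  ultimately have "racah_ideal \<subseteq> ?I"
    unfolding racah_ideal_def by (intro hull_minimal)
  with assms show ?thesis by blast
qed

lemma racah_cong_mult:
  assumes "x - x' \<in> racah_ideal" "y - y' \<in> racah_ideal"
  shows "x * y - x' * y' \<in> racah_ideal"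
proof -
  have "x * y - x' * y' = (x - x') * y + x' * (y - y')"
    by (simp add: algebra_simps)
  then show ?thesis using assms by (auto intro: racah_ideal_intros)
qed

quotient_type (overloaded) 'f racah = "(racah_gen, 'f::field) free_algebra"
  / "\<lambda>x y. x - y \<in> racah_ideal"
proof (intro equivpI reflpI sympI transpI)
  fix x y z :: "(racah_gen, 'f) free_algebra"
  show "x - x \<in> racah_ideal"
    by (simp add: racah_ideal_intros)
  show "y - x \<in> racah_ideal" if "x - y \<in> racah_ideal"
    using racah_ideal_intros(5)[OF that] by simp
  show "x - z \<in> racah_ideal" if "x - y \<in> racah_ideal" "y - z \<in> racah_ideal"
    using racah_ideal_intros(2)[OF that] by simp
qed

instantiation racah :: (field) ring_1
begin

lift_definition zero_racah :: "'a racah" is 0 .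

lift_definition one_racah :: "'a racah" is 1 .

lift_definition plus_racah :: "'a racah \<Rightarrow> 'a racah \<Rightarrow> 'a racah" is "(+)"
  by (simp only: add_diff_add racah_ideal_intros(2))

lift_definition uminus_racah :: "'a racah \<Rightarrow> 'a racah" is uminus
  by (simp only: minus_diff_minus racah_ideal_intros(5))

lift_definition minus_racah :: "'a racah \<Rightarrow> 'a racah \<Rightarrow> 'a racah" is "(-)"
proof -
  fix x x' y y' :: "(racah_gen, 'a) free_algebra"
  assume *: "x - x' \<in> racah_ideal" "y - y' \<in> racah_ideal"
  have "x - y - (x' - y') = (x - x') - (y - y')" by simp
  with * show "x - y - (x' - y') \<in> racah_ideal" by (simp only: racah_ideal_intros(6))
qed

lift_definition times_racah :: "'a racah \<Rightarrow> 'a racah \<Rightarrow> 'a racah" is "(*)"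
  by (rule racah_cong_mult)

instance
proof
  show "(0 :: 'a racah) \<noteq> 1"
    by transfer (auto dest!: racah_ideal_lookup_0 simp: lookup_minus)
qed (transfer; simp add: algebra_simps racah_ideal_intros(1))+

end

lift_definition racah_scale :: "'f::field \<Rightarrow> 'f racah \<Rightarrow> 'f racah" is free_scale
  by (simp add: free_scale_conv_mult racah_ideal_intros flip: right_diff_distrib)

lift_definition racah_gen :: "racah_gen \<Rightarrow> 'f::field racah" is free_gen .

definition racah_A :: "'f::field racah" where "racah_A = racah_gen Gen_A"
definition racah_B :: "'f::field racah" where "racah_B = racah_gen Gen_B"
definition racah_C :: "'f::field racah" where "racah_C = racah_gen Gen_C"
definition racah_D :: "'f::field racah" where "racah_D = racah_gen Gen_D"

definition racah_alpha :: "'f::field racah" where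
  "racah_alpha = commutator racah_A racah_D + racah_A * racah_C - racah_B * racah_A"

definition racah_beta :: "'f::field racah" where
  "racah_beta = commutator racah_B racah_D + racah_B * racah_A - racah_C * racah_B"

definition racah_gamma :: "'f::field racah" where
  "racah_gamma = commutator racah_C racah_D + racah_C * racah_B - racah_A * racah_C"

definition racah_delta :: "'f::field racah" where
  "racah_delta = racah_A + racah_B + racah_C"

lemmas racah_gen_defs = racah_A_def racah_B_def racah_C_def racah_D_def

lemma vector_space_racah_scale: "vector_space (racah_scale :: 'f::field \<Rightarrow> _)"
proof
  fix a b :: 'f and x y :: "'f racah"
  show "racah_scale a (x + y) = racah_scale a x + racah_scale a y"
    by transfer (simp add: free_scale_conv_mult algebra_simps racah_ideal_intros(1))
  show "racah_scale (a + b) x = racah_scale a x + racah_scale b x"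
    by transfer (simp add: free_scale_conv_mult single_add algebra_simps racah_ideal_intros(1))
  show "racah_scale a (racah_scale b x) = racah_scale (a * b) x"
    by transfer
      (simp add: free_scale_conv_mult mult_single racah_ideal_intros(1) flip: mult.assoc)
  show "racah_scale 1 x = x"
    by transfer (simp add: free_scale_conv_mult racah_ideal_intros(1))
qed

lemma racah_scale_mult_left: "racah_scale c x * y = racah_scale c (x * y)"
  by transfer (simp add: free_scale_conv_mult mult.assoc racah_ideal_intros(1))

lemma racah_scale_mult_right: "x * racah_scale c y = racah_scale c (x * y)"
proof transfer
  fix c :: "'f::field" and x y :: "(racah_gen, 'f) free_algebra"
  have "x * free_scale c y = (x * Poly_Mapping.single 0 c) * y"
    by (simp only: free_scale_conv_mult mult.assoc)
  also have "\<dots> = free_scale c (x * y)"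
    by (simp only: free_scale_conv_mult mult.assoc flip: single_0_commute)
  finally show "x * free_scale c y - free_scale c (x * y) \<in> racah_ideal"
    by (simp only: diff_self racah_ideal_intros(1))
qed

lemma racah_relations:
  "commutator racah_A racah_B = 2 * (racah_D :: 'f::field racah)"
  "commutator racah_B racah_C = 2 * (racah_D :: 'f::field racah)"
  "commutator racah_C racah_A = 2 * (racah_D :: 'f::field racah)"
proof -
  define A B C D :: "(racah_gen, 'f) free_algebra"
    where "A = free_gen Gen_A" and "B = free_gen Gen_B"
      and "C = free_gen Gen_C" and "D = free_gen Gen_D"
  note gens = A_def B_def C_def D_def
  have "{commutator A B - 2 * D, commutator B C - 2 * D, commutator C A - 2 * D} \<subseteq> racah_relators"
    unfolding racah_relators_def Let_def gens by blast
  then have *: "commutator A B - 2 * D \<in> racah_ideal" "commutator B C - 2 * D \<in> racah_ideal"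
    "commutator C A - 2 * D \<in> racah_ideal"
    using racah_relators_subset by blast+
  note * = *[unfolded gens commutator_def mult_2]
  show "commutator racah_A racah_B = 2 * (racah_D :: 'f racah)"
    unfolding commutator_def racah_gen_defs mult_2 by transfer (rule *)
  show "commutator racah_B racah_C = 2 * (racah_D :: 'f racah)"
    unfolding commutator_def racah_gen_defs mult_2 by transfer (rule *)
  show "commutator racah_C racah_A = 2 * (racah_D :: 'f racah)"
    unfolding commutator_def racah_gen_defs mult_2 by transfer (rule *)
qed

lemma racah_central:
  fixes x :: "'f::field racah"
  shows "racah_alpha * x = x * racah_alpha"
    and "racah_beta * x = x * racah_beta"
    and "racah_gamma * x = x * racah_gamma"
proof -
  define A B C D :: "(racah_gen, 'f) free_algebra"
    where "A = free_gen Gen_A" and "B = free_gen Gen_B"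
      and "C = free_gen Gen_C" and "D = free_gen Gen_D"
  note gens = A_def B_def C_def D_def
  have *: "commutator (commutator A D + A * C - B * A) y \<in> racah_ideal"
    "commutator (commutator B D + B * A - C * B) y \<in> racah_ideal"
    "commutator (commutator C D + C * B - A * C) y \<in> racah_ideal" for y
    by (rule subsetD[OF racah_relators_subset],
        unfold racah_relators_def Let_def gens, blast)+
  note * = *[unfolded gens commutator_def]
  show "racah_alpha * x = x * racah_alpha"
    unfolding racah_alpha_def commutator_def racah_gen_defs by transfer (rule *)
  show "racah_beta * x = x * racah_beta"
    unfolding racah_beta_def commutator_def racah_gen_defs by transfer (rule *)
  show "racah_gamma * x = x * racah_gamma"
    unfolding racah_gamma_def commutator_def racah_gen_defs by transfer (rule *)
qed

definition racah_subalgebra :: "'f::field racah set \<Rightarrow> bool" where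
  "racah_subalgebra S \<longleftrightarrow> 1 \<in> S \<and> (\<forall>x\<in>S. \<forall>y\<in>S. x + y \<in> S \<and> x * y \<in> S) \<and>
     (\<forall>c. \<forall>x\<in>S. racah_scale c x \<in> S)"

definition racah_frakC :: "'f::field racah set" where
  "racah_frakC = racah_subalgebra hull {racah_alpha, racah_beta, racah_gamma, racah_delta}"

definition casimir_class :: "'f::field racah set" where
  "casimir_class =
    (let A = racah_A; B = racah_B; D = racah_D;
         \<alpha> = racah_alpha; \<beta> = racah_beta; \<delta> = racah_delta in
      {D^2 + A^2 + B^2
         + racah_scale (1 / 2)
             ((\<delta> + 2) * anticommutator A B - anticommutator (A^2) B - anticommutator A (B^2))
         + A * (\<beta> - \<delta>) - B * (\<delta> + \<alpha>) + c | c. c \<in> racah_frakC})"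

text \<open>
  The evaluation map \<^const>\<open>poly\<close> is restricted to commutative coefficient types, and
  \<open>'f racah\<close> is not commutative, so the value \<open>p(\<Omega>)\<close> is written out as a sum.
\<close>

definition alg_independent_over :: "'r::ring_1 set \<Rightarrow> 'r \<Rightarrow> bool" where
  "alg_independent_over R \<Omega> \<longleftrightarrow>
    (\<forall>p :: 'r poly. (\<forall>i. coeff p i \<in> R) \<and> p \<noteq> 0 \<longrightarrow>
      (\<Sum>i\<le>degree p. coeff p i * \<Omega> ^ i) \<noteq> 0)"

end

theory Submission
  imports Defs "HOL-Library.Function_Algebras" "HOL-Computational_Algebra.Polynomial_Factorial"
begin

text \<open>
  For arbitrary scalars \<open>\<alpha>, \<beta>, \<delta>, \<omega>\<close> in \<open>K = Frac F[X]\<close> the Racah algebra acts on the functions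
  \<open>\<int> \<rightarrow> K\<close>, with \<open>A\<close> diagonal and \<open>B\<close> tridiagonal, so that the three central elements and a given
  Casimir element act as these scalars; the variable \<open>X\<close> shifts the spectrum of \<open>A\<close> and keeps the
  denominators away from zero in every characteristic other than two. Elements of the subalgebra
  are polynomials in \<open>\<alpha>, \<beta>, \<delta>\<close>, because \<open>\<gamma> = - \<alpha> - \<beta>\<close>. Since \<open>K\<close> is infinite, a nonzero polynomial
  in \<open>\<alpha>, \<beta>, \<delta>, \<omega>\<close> takes a nonzero value at some choice of the scalars, hence does not vanish
  in the algebra.
\<close>

section \<open>Modules over the free algebra and over the Racah algebra\<close>

text \<open>Universal property of the free algebra: any family of linear endomorphisms indexed by
  the letters yields a module.\<close>

locale free_algebra_module = vector_space scale
  for scale :: "'f::field \<Rightarrow> 'v::ab_group_add \<Rightarrow> 'v"  (infixr \<open>*s\<close> 75) +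
  fixes T :: "'g \<Rightarrow> 'v \<Rightarrow> 'v"
  assumes T_add: "T g (u + v) = T g u + T g v"
    and T_scale: "T g (c *s v) = c *s T g v"
begin

text \<open>The last letter of a word acts first, so concatenation becomes composition and the
  module is a left module.\<close>

definition act :: "('g, 'f) free_algebra \<Rightarrow> 'v \<Rightarrow> 'v" where
  "act x v = (\<Sum>w\<in>Poly_Mapping.keys x. Poly_Mapping.lookup x w *s foldr T (letters w) v)"

lemma act_superset:
  assumes "finite S" "Poly_Mapping.keys x \<subseteq> S"
  shows "act x v = (\<Sum>w\<in>S. Poly_Mapping.lookup x w *s foldr T (letters w) v)"
  unfolding act_def using assms
  by (intro sum.mono_neutral_left) (auto simp: in_keys_iff)

lemma act_add: "act (x + y) v = act x v + act y v"
proof -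
  let ?S = "Poly_Mapping.keys x \<union> Poly_Mapping.keys y"
  have "act z v = (\<Sum>w\<in>?S. Poly_Mapping.lookup z w *s foldr T (letters w) v)"
    if "z \<in> {x, y, x + y}" for z
    using that keys_add[of x y] by (intro act_superset) auto
  then show ?thesis
    by (simp add: lookup_add scale_left_distrib sum.distrib)
qed

lemma act_0: "act 0 v = 0"
  by (simp add: act_def)

lemma act_uminus: "act (- x) v = - act x v"
  using act_add[of x "- x" v] by (simp add: act_0 add_eq_0_iff)

lemma act_diff: "act (x - y) v = act x v - act y v"
  using act_add[of x "- y" v] by (simp add: act_uminus)

lemma act_single: "act (Poly_Mapping.single w c) v = c *s foldr T (letters w) v"
  by (simp add: act_def)

lemma act_one: "act 1 v = v"
  by (simp add: act_single zero_word_def flip: single_one)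

lemma act_free_gen: "act (free_gen g) v = T g v"
  by (simp add: free_gen_def act_single)

lemma foldr_T_add: "foldr T ws (u + v) = foldr T ws u + foldr T ws v"
  by (induction ws) (simp_all add: T_add)

lemma foldr_T_scale: "foldr T ws (c *s v) = c *s foldr T ws v"
  by (induction ws) (simp_all add: T_scale)

lemma act_add_right: "act x (u + v) = act x u + act x v"
  by (simp add: act_def foldr_T_add scale_right_distrib sum.distrib)

lemma act_0_right: "act x 0 = 0"
  using act_add_right[of x 0 0] by simp

lemma act_scale_right: "act x (c *s v) = c *s act x v"
  by (simp add: act_def foldr_T_scale scale_sum_right mult.commute)

lemma act_mult: "act (x * y) v = act x (act y v)"
proof (induction x rule: free_algebra_induct)
  case (single k a)
  show ?case
  proof (induction y rule: free_algebra_induct)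
    case (single l b)
    then show ?case
      by (simp add: mult_single act_single plus_word_def foldr_T_scale)
  next
    case (sum p l b)
    then show ?case by (simp add: distrib_left act_add act_add_right)
  qed
next
  case (sum p k a)
  then show ?case by (simp add: distrib_right act_add)
qed

lemma act_free_scale: "act (free_scale c x) v = c *s act x v"
  by (simp add: free_scale_conv_mult act_mult act_single zero_word_def)

text \<open>Reduces the centrality relators, which range over the whole free algebra, to a check on
  the generators.\<close>

lemma act_commute:
  assumes "\<And>g v. act z (T g v) = T g (act z v)"
  shows "act z (act x v) = act x (act z v)"
proof (induction x rule: free_algebra_induct)
  case (single k c)
  have "act z (foldr T ws v) = foldr T ws (act z v)" for ws
    by (induction ws) (simp_all add: assms)
  then show ?case by (simp add: act_single act_scale_right)
next
  case (sum p k c)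
  then show ?case by (simp add: act_add act_add_right)
qed

lemma two_sided_ideal_annihilator: "two_sided_ideal {x. \<forall>v. act x v = 0}"
  by (auto simp: two_sided_ideal_def act_add act_mult act_0 act_0_right)

end

locale racah_module = vector_space scale
  for scale :: "'f::field \<Rightarrow> 'v::ab_group_add \<Rightarrow> 'v"  (infixr \<open>*s\<close> 75) +
  fixes T :: "racah_gen \<Rightarrow> 'v \<Rightarrow> 'v" and A B C D :: "'v \<Rightarrow> 'v"
  assumes T_gen: "T Gen_A = A" "T Gen_B = B" "T Gen_C = C" "T Gen_D = D"
    and T_add: "T g (u + v) = T g u + T g v"
    and T_scale: "T g (c *s v) = c *s T g v"
    and AB: "A (B v) - B (A v) = D v + D v"
    and BC: "B (C v) - C (B v) = D v + D v"
    and CA: "C (A v) - A (C v) = D v + D v"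
    and alpha_commutes: "A (D (T g v)) - D (A (T g v)) + A (C (T g v)) - B (A (T g v)) =
      T g (A (D v) - D (A v) + A (C v) - B (A v))"
    and beta_commutes: "B (D (T g v)) - D (B (T g v)) + B (A (T g v)) - C (B (T g v)) =
      T g (B (D v) - D (B v) + B (A v) - C (B v))"
    and gamma_commutes: "C (D (T g v)) - D (C (T g v)) + C (B (T g v)) - A (C (T g v)) =
      T g (C (D v) - D (C v) + C (B v) - A (C v))"
begin

sublocale free_algebra_module scale T
  by unfold_locales (simp_all add: T_add T_scale)

text \<open>The annihilator of the module is a two-sided ideal containing all relators, hence
  contains the ideal they generate.\<close>

lemma act_racah_ideal:
  assumes "x \<in> racah_ideal"
  shows "act x v = 0"
proof -
  note ops = act_add act_diff act_mult act_free_gen commutator_def mult_2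
    T_gen
  have comm: "act (commutator z x) v = 0"
    if "\<And>g v. act z (T g v) = T g (act z v)" for x z v
    using act_commute[of z x v, OF that] by (simp add: ops)
  have "act (commutator (commutator (free_gen Gen_A) (free_gen Gen_D)
      + free_gen Gen_A * free_gen Gen_C - free_gen Gen_B * free_gen Gen_A) x) v = 0"
    "act (commutator (commutator (free_gen Gen_B) (free_gen Gen_D)
      + free_gen Gen_B * free_gen Gen_A - free_gen Gen_C * free_gen Gen_B) x) v = 0"
    "act (commutator (commutator (free_gen Gen_C) (free_gen Gen_D)
      + free_gen Gen_C * free_gen Gen_B - free_gen Gen_A * free_gen Gen_C) x) v = 0" for x v
    by (intro comm; simp add: ops alpha_commutes beta_commutes gamma_commutes)+
  moreover have "act (commutator (free_gen Gen_A) (free_gen Gen_B) - 2 * free_gen Gen_D) v = 0"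
    "act (commutator (free_gen Gen_B) (free_gen Gen_C) - 2 * free_gen Gen_D) v = 0"
    "act (commutator (free_gen Gen_C) (free_gen Gen_A) - 2 * free_gen Gen_D) v = 0" for v
    by (simp_all add: ops AB BC CA)
  ultimately have "racah_relators \<subseteq> {x. \<forall>v. act x v = 0}"
    by (auto simp: racah_relators_def Let_def)
  then have "racah_ideal \<subseteq> {x. \<forall>v. act x v = 0}"
    unfolding racah_ideal_def by (intro hull_minimal two_sided_ideal_annihilator)
  with assms show ?thesis by blast
qed

text \<open>The choice of representative is harmless, since two representatives differ by an element
  of the ideal, which acts as zero.\<close>

definition racah_act :: "'f racah \<Rightarrow> 'v \<Rightarrow> 'v" where
  "racah_act x = act (rep_racah x)"

lemma racah_act_abs: "racah_act (abs_racah x) v = act x v"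
proof -
  have "abs_racah (rep_racah (abs_racah x)) = abs_racah x"
    by (rule Quotient3_abs_rep[OF Quotient3_racah])
  then have "rep_racah (abs_racah x) - x \<in> racah_ideal"
    by (simp add: racah.abs_eq_iff)
  then have "act (rep_racah (abs_racah x) - x) v = 0"
    by (rule act_racah_ideal)
  then show ?thesis by (simp add: racah_act_def act_diff)
qed

lemma racah_act_0: "racah_act 0 v = 0"
  by (simp add: zero_racah_def racah_act_abs act_0)

lemma racah_act_1: "racah_act 1 v = v"
  by (simp add: one_racah_def racah_act_abs act_one)

lemma racah_act_add: "racah_act (x + y) v = racah_act x v + racah_act y v"
  by (induction x rule: racah.abs_induct, induction y rule: racah.abs_induct) (simp add: plus_racah.abs_eq racah_act_abs act_add)

lemma racah_act_2: "racah_act 2 v = v + v"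
  by (simp add: racah_act_add racah_act_1 flip: one_add_one)

lemma racah_act_diff: "racah_act (x - y) v = racah_act x v - racah_act y v"
  by (induction x rule: racah.abs_induct, induction y rule: racah.abs_induct) (simp add: minus_racah.abs_eq racah_act_abs act_diff)

lemma racah_act_mult: "racah_act (x * y) v = racah_act x (racah_act y v)"
  by (induction x rule: racah.abs_induct, induction y rule: racah.abs_induct) (simp add: times_racah.abs_eq racah_act_abs act_mult)

lemma racah_act_scale: "racah_act (racah_scale c x) v = c *s racah_act x v"
  by (induction x rule: racah.abs_induct) (simp add: racah_scale.abs_eq racah_act_abs act_free_scale)

lemma racah_act_gen:
  "racah_act racah_A v = A v" "racah_act racah_B v = B v"
  "racah_act racah_C v = C v" "racah_act racah_D v = D v"
  by (simp_all add: racah_gen_defs racah_gen_def racah_act_abs act_free_gen T_gen)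

end

section \<open>Extending homomorphisms to polynomials\<close>

definition ring_morphism :: "('a::ring_1 \<Rightarrow> 'r::ring_1) \<Rightarrow> bool" where
  "ring_morphism \<phi> \<longleftrightarrow> \<phi> 0 = 0 \<and> \<phi> 1 = 1 \<and>
     (\<forall>x y. \<phi> (x + y) = \<phi> x + \<phi> y) \<and> (\<forall>x y. \<phi> (x * y) = \<phi> x * \<phi> y)"

text \<open>Horner evaluation at \<open>z\<close> with coefficients mapped by \<phi>; the target
  ring may be noncommutative.\<close>

definition poly_ext :: "('a::comm_ring_1 \<Rightarrow> 'r::ring_1) \<Rightarrow> 'r \<Rightarrow> 'a poly \<Rightarrow> 'r" where
  "poly_ext \<phi> z p = fold_coeffs (\<lambda>a r. \<phi> a + z * r) p 0"

lemma poly_ext_0 [simp]: "poly_ext \<phi> z 0 = 0"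
  by (simp add: poly_ext_def)

lemma poly_ext_pCons:
  assumes "\<phi> 0 = 0"
  shows "poly_ext \<phi> z (pCons a p) = \<phi> a + z * poly_ext \<phi> z p"
  using assms by (cases "p = 0 \<and> a = 0") (auto simp: poly_ext_def)

text \<open>Lets the extension be iterated: the next element to be adjoined must commute with all
  values of the previous extension.\<close>

lemma poly_ext_commute:
  assumes "\<phi> 0 = 0" "\<And>a. \<phi> a * y = y * \<phi> a" "z * y = y * z"
  shows "poly_ext \<phi> z p * y = y * poly_ext \<phi> z p"
proof (induction p)
  case (pCons a p)
  have "z * poly_ext \<phi> z p * y = z * y * poly_ext \<phi> z p"
    by (simp add: mult.assoc pCons.IH)
  also have "\<dots> = y * (z * poly_ext \<phi> z p)"
    by (simp add: assms(3) mult.assoc)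
  finally show ?case
    using assms by (simp add: poly_ext_pCons algebra_simps)
qed simp

lemma ring_morphism_poly_ext:
  assumes "ring_morphism \<phi>" and z: "\<And>a. \<phi> a * z = z * \<phi> a"
  shows "ring_morphism (poly_ext \<phi> z)"
proof -
  have \<phi>: "\<phi> 0 = 0" "\<phi> 1 = 1" "\<phi> (x + y) = \<phi> x + \<phi> y" "\<phi> (x * y) = \<phi> x * \<phi> y" for x y
    using assms(1) by (auto simp: ring_morphism_def)
  have add: "poly_ext \<phi> z (p + q) = poly_ext \<phi> z p + poly_ext \<phi> z q" for p q
    by (induction p q rule: poly_induct2) (simp_all add: poly_ext_pCons \<phi> algebra_simps)
  \<comment> \<open>This is where \<phi> a has to be moved past \<open>z\<close>; multiplicativity
    then follows by induction on the left factor.\<close>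
  have smult: "poly_ext \<phi> z (smult a q) = \<phi> a * poly_ext \<phi> z q" for a q
  proof (induction q)
    case (pCons b q)
    have "z * (\<phi> a * poly_ext \<phi> z q) = \<phi> a * (z * poly_ext \<phi> z q)"
      by (simp add: z flip: mult.assoc)
    with pCons show ?case by (simp add: poly_ext_pCons \<phi> algebra_simps)
  qed simp
  have "poly_ext \<phi> z (p * q) = poly_ext \<phi> z p * poly_ext \<phi> z q" for p q
    by (induction p) (simp_all add: poly_ext_pCons \<phi> add smult algebra_simps)
  moreover have "poly_ext \<phi> z 1 = 1"
    by (simp add: one_pCons poly_ext_pCons \<phi>)
  ultimately show ?thesis
    by (simp add: ring_morphism_def add)
qed

text \<open>Used with \<open>acts\<close> for \<open>P\<close>, to read off the scalar by which a
  polynomial in central elements acts.\<close>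

lemma poly_ext_related:
  assumes "P 0 0" "\<And>r k r' k'. P r k \<Longrightarrow> P r' k' \<Longrightarrow> P (r + r') (k + k')"
    "\<And>r k r' k'. P r k \<Longrightarrow> P r' k' \<Longrightarrow> P (r * r') (k * k')"
    "\<phi> 0 = 0" "\<psi> 0 = 0" "\<And>a. P (\<phi> a) (\<psi> a)" "P z y"
  shows "P (poly_ext \<phi> z p) (poly_ext \<psi> y p)"
  by (induction p) (simp_all add: poly_ext_pCons assms)

lemma ex_poly_ext_nonzero:
  fixes \<phi> :: "'a::comm_ring_1 \<Rightarrow> 'k::field"
  assumes "infinite (UNIV :: 'k set)" "\<phi> 0 = 0" "\<phi> (coeff p i) \<noteq> 0"
  shows "\<exists>z. poly_ext \<phi> z p \<noteq> 0"
proof -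
  have ext: "poly_ext \<phi> z p = poly (map_poly \<phi> p) z" for z
    by (induction p) (simp_all add: poly_ext_pCons map_poly_pCons assms)
  have "map_poly \<phi> p \<noteq> 0"
    using assms(2,3) by (metis coeff_0 coeff_map_poly)
  then have "finite {z. poly (map_poly \<phi> p) z = 0}"
    by (rule poly_roots_finite)
  with assms(1) have "{z. poly (map_poly \<phi> p) z = 0} \<noteq> UNIV"
    by metis
  then show ?thesis by (auto simp: ext)
qed

section \<open>Representations with prescribed central characters\<close>

text \<open>
  The point \<open>x\<^sub>i\<close> of the lattice on which \<open>A\<close> acts by \<open>x\<^sub>i\<^sup>2 - 1/4\<close> is \<open>m i + 1/2\<close>.
  The coefficients \<open>B1\<close> and \<open>G\<close> are forced by the diagonal entries of the relation defining
  \<open>\<alpha>\<close> and of those for \<open>\<beta>\<close> and the Casimir element: the relation for \<open>\<beta>\<close> is a first order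
  recurrence for \<open>(4 m\<^sup>2 - 1) G\<close>, and the Casimir value \<open>\<omega>\<close> enters as its constant of integration.
\<close>

locale racah_lattice =
  fixes \<iota> :: "'f::field \<Rightarrow> 'k::field" and m :: "int \<Rightarrow> 'k" and \<alpha> \<beta> \<delta> \<omega> :: 'k
  assumes \<iota>: "ring_morphism \<iota>"
    and two: "(2 :: 'k) \<noteq> 0"
    and m_Suc: "m (i + 1) = m i + 1"
    and m_nz: "m i \<noteq> 0"
    and m_half: "2 * m i - 1 \<noteq> 0"
begin

definition h :: 'k where "h = inverse 2"

definition n :: "int \<Rightarrow> 'k" where "n i = inverse (m i)"

definition \<theta> :: "int \<Rightarrow> 'k" where "\<theta> i = m i * (m i + 1)"

definition B1 :: "int \<Rightarrow> 'k" where "B1 i = h * (\<delta> - \<theta> i - \<alpha> * (n i * n (i + 1)))"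

definition H :: "int \<Rightarrow> 'k" where
  "H i = h * h * ((m i)\<^sup>2 * ((m i)\<^sup>2 - 1 - \<delta>)\<^sup>2 + \<alpha>\<^sup>2 * (n i)\<^sup>2) + \<beta> * (m i)\<^sup>2 + h * \<alpha> * (m i)\<^sup>2
     - (\<omega> + h * h * \<delta>\<^sup>2 + h * \<alpha> * \<delta> + h * \<alpha>)"

definition G :: "int \<Rightarrow> 'k" where "G i = H i / ((2 * m i - 1) * (2 * m i + 1))"

text \<open>Inverses enter the computations below through polynomial equations such as
  \<open>2 * h = 1\<close> and \<open>m i * n i = 1\<close>, which \<open>algebra\<close> can
  use.\<close>

lemma h2: "2 * h = 1"
  using two by (simp add: h_def)

lemma mn: "m i * n i = 1"
  using m_nz by (simp add: n_def)

lemma mn_Suc: "(m i + 1) * n (i + 1) = 1"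
  using mn[of "i + 1"] by (simp add: m_Suc)

lemma mn_Suc2: "(m i + 2) * n (i + 2) = 1"
  using mn[of "i + 2"] m_Suc[of "i + 1"] m_Suc[of i] by (simp add: add.assoc)

lemma m_half': "2 * m i + 1 \<noteq> 0"
  using m_half[of "i + 1"] unfolding m_Suc by (simp add: algebra_simps)

lemma G_H: "G i * ((2 * m i - 1) * (2 * m i + 1)) = H i"
  using m_half[of i] m_half'[of i] by (simp add: G_def)

lemma G_H_Suc: "G (i + 1) * ((2 * m i + 1) * (2 * m i + 3)) = H (i + 1)"
  using G_H[of "i + 1"] unfolding m_Suc by (simp add: algebra_simps)

section \<open>Scalar identities for the matrix entries of the relations and of the Casimir
  element\<close>

lemma alpha_diag: "2 * \<theta> i * B1 i = \<delta> * \<theta> i - (\<theta> i)\<^sup>2 - \<alpha>"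
  using h2 mn[of i] mn_Suc[of i] unfolding B1_def \<theta>_def by algebra

lemma theta_Suc: "\<theta> (i + 1) = (m i + 1) * (m i + 2)"
  unfolding \<theta>_def m_Suc by (simp add: algebra_simps)

lemma B1_Suc: "B1 (i + 1) = h * (\<delta> - \<theta> (i + 1) - \<alpha> * (n (i + 1) * n (i + 2)))"
  by (simp add: B1_def add.assoc)

text \<open>The off-diagonal factor of the \<beta> relation. Its \<alpha> terms cancel, because
  \<open>m i * n i\<close> and \<open>(m i + 2) * n (i + 2)\<close> are both 1.\<close>

lemma beta_off: "(m i + 2) * B1 (i + 1) - m i * B1 i + \<theta> i + \<theta> (i + 1) - \<delta> = 0"
proof -
  have "m i * B1 i = h * (m i * (\<delta> - \<theta> i) - \<alpha> * n (i + 1) * (m i * n i))"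
    unfolding B1_def by algebra
  moreover have "(m i + 2) * B1 (i + 1) =
      h * ((m i + 2) * (\<delta> - \<theta> (i + 1)) - \<alpha> * n (i + 1) * ((m i + 2) * n (i + 2)))"
    unfolding B1_Suc by algebra
  moreover have "(m i + 2) * \<theta> (i + 1) - m i * \<theta> i = 2 * (\<theta> i + \<theta> (i + 1))"
    unfolding theta_Suc \<theta>_def[of i] by algebra
  ultimately show ?thesis
    using h2 unfolding mn mn_Suc2 by algebra
qed

text \<open>Makes everything polynomial in \<open>m i\<close> and the single quantity
  \<open>n i * n (i + 1)\<close>, the inverse of \<open>\<theta> i\<close>.\<close>

lemma n_conv:
  "n i = n i * n (i + 1) * (m i + 1)" "n (i + 1) = n i * n (i + 1) * m i"
  "\<theta> i * (n i * n (i + 1)) = 1"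
  using mn[of i] mn_Suc[of i] unfolding \<theta>_def by algebra+

text \<open>Eliminates \<open>B1\<close> from the diagonal of the \<beta> relation; the terms linear
  in \<alpha> collapse because \<open>\<theta> i * (n i * n (i + 1)) = 1\<close>.\<close>

lemma B1_quadratic:
  "(B1 i)\<^sup>2 + 2 * \<theta> i * B1 i - \<delta> * B1 i =
     h * h * ((\<delta> - \<theta> i) * (3 * \<theta> i - \<delta>) + \<alpha>\<^sup>2 * (n i * n (i + 1))\<^sup>2) - h * \<alpha>"
proof -
  define r where "r = n i * n (i + 1)"
  have "\<theta> i * r = 1" "B1 i = h * (\<delta> - \<theta> i - \<alpha> * r)"
    using n_conv(3)[of i] by (simp_all add: r_def B1_def)
  then show ?thesis using h2 unfolding r_def[symmetric] by algebra
qed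

lemma H_poly_diff:
  fixes x d :: 'k
  shows "(x + 1)\<^sup>2 * ((x + 1)\<^sup>2 - 1 - d)\<^sup>2 - x\<^sup>2 * (x\<^sup>2 - 1 - d)\<^sup>2 =
    - ((2 * x + 1) * ((d - x * (x + 1)) * (3 * (x * (x + 1)) - d)))"
  by algebra

text \<open>The recurrence behind the \<beta> relation. The constant of integration drops out, and
  the squares of \<open>m\<close> and \<open>n\<close> each contribute a factor
  \<open>2 * m i + 1\<close>.\<close>

lemma H_diff:
  "H (i + 1) - H i = (2 * m i + 1) * (\<beta> - (B1 i)\<^sup>2 - 2 * \<theta> i * B1 i + \<delta> * B1 i)"
proof -
  define r where "r = n i * n (i + 1)"
  have n: "n i = r * (m i + 1)" "n (i + 1) = r * m i"
    unfolding r_def by (fact n_conv)+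
  have "H (i + 1) - H i = h * h * ((m i + 1)\<^sup>2 * ((m i + 1)\<^sup>2 - 1 - \<delta>)\<^sup>2
      - (m i)\<^sup>2 * ((m i)\<^sup>2 - 1 - \<delta>)\<^sup>2) - (2 * m i + 1) * (h * h * \<alpha>\<^sup>2 * r\<^sup>2)
      + (2 * m i + 1) * (\<beta> + h * \<alpha>)"
    unfolding H_def m_Suc n by algebra
  also have "\<dots> = (2 * m i + 1) * (\<beta> - ((B1 i)\<^sup>2 + 2 * \<theta> i * B1 i - \<delta> * B1 i))"
    unfolding H_poly_diff B1_quadratic unfolding \<theta>_def r_def by algebra
  finally show ?thesis by (simp add: algebra_simps)
qed

lemma beta_diag:
  "G (i + 1) * (2 * m i + 3) - G i * (2 * m i - 1) + (B1 i)\<^sup>2 + 2 * \<theta> i * B1 i - \<delta> * B1 i = \<beta>"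
proof -
  \<comment> \<open>The factor \<open>2 * m i + 1\<close> turns both \<open>G\<close> terms into
    \<open>H\<close> terms.\<close>
  have "(2 * m i + 1) * (G (i + 1) * (2 * m i + 3) - G i * (2 * m i - 1) + (B1 i)\<^sup>2
      + 2 * \<theta> i * B1 i - \<delta> * B1 i) = (2 * m i + 1) * \<beta>"
    using H_diff[of i] G_H[of i] G_H_Suc[of i] by algebra
  then show ?thesis using m_half'[of i] by simp
qed

lemma casimir_quadratic:
  "(\<theta> i)\<^sup>2 + (B1 i)\<^sup>2
     + (\<delta> + 2) * \<theta> i * B1 i - (\<theta> i)\<^sup>2 * B1 i - \<theta> i * (B1 i)\<^sup>2 + \<theta> i * (\<beta> - \<delta>)
     - B1 i * (\<delta> + \<alpha>) =
   h * h * (4 * (\<theta> i)\<^sup>2 + (\<delta> - \<theta> i)\<^sup>2 * (1 - \<theta> i)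
       + 2 * (\<delta> - \<theta> i) * ((\<delta> + 2) * \<theta> i - (\<theta> i)\<^sup>2 - \<delta>) - 4 * \<theta> i * \<delta>)
     + \<theta> i * \<beta> + h * \<alpha> * (\<theta> i - \<delta> - 1)
     + h * h * \<alpha>\<^sup>2 * (n i * n (i + 1))\<^sup>2 * (1 + \<theta> i)"
proof -
  define r where "r = n i * n (i + 1)"
  have "\<theta> i * r = 1" "B1 i = h * (\<delta> - \<theta> i - \<alpha> * r)"
    using n_conv(3)[of i] by (simp_all add: r_def B1_def)
  then show ?thesis using h2 unfolding r_def[symmetric] by algebra
qed

lemma H_poly_sum:
  fixes x d :: 'k
  shows "x * (x + 1)\<^sup>2 * ((x + 1)\<^sup>2 - 1 - d)\<^sup>2 + (x + 1) * x\<^sup>2 * (x\<^sup>2 - 1 - d)\<^sup>2 =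
    (2 * x + 1) * (4 * (x * (x + 1))\<^sup>2 + (d - x * (x + 1))\<^sup>2 * (1 - x * (x + 1))
       + 2 * (d - x * (x + 1)) * ((d + 2) * (x * (x + 1)) - (x * (x + 1))\<^sup>2 - d)
       - 4 * (x * (x + 1)) * d + d\<^sup>2)"
  by algebra

text \<open>The weights \<open>m i\<close> and \<open>m i + 1\<close> add up to
  \<open>2 * m i + 1\<close>, so unlike in \<open>H_diff\<close> the constant of integration
  survives and determines \<omega>.\<close>

lemma H_sum:
  "- m i * H (i + 1) - (m i + 1) * H i = (2 * m i + 1) * (\<omega> - ((\<theta> i)\<^sup>2 + (B1 i)\<^sup>2
     + (\<delta> + 2) * \<theta> i * B1 i - (\<theta> i)\<^sup>2 * B1 i - \<theta> i * (B1 i)\<^sup>2 + \<theta> i * (\<beta> - \<delta>)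
     - B1 i * (\<delta> + \<alpha>)))"
proof -
  define r where "r = n i * n (i + 1)"
  have n: "n i = r * (m i + 1)" "n (i + 1) = r * m i"
    unfolding r_def by (fact n_conv)+
  have "- m i * H (i + 1) - (m i + 1) * H i =
      - (h * h * (m i * (m i + 1)\<^sup>2 * ((m i + 1)\<^sup>2 - 1 - \<delta>)\<^sup>2
          + (m i + 1) * (m i)\<^sup>2 * ((m i)\<^sup>2 - 1 - \<delta>)\<^sup>2))
      - (2 * m i + 1) * (h * h * \<alpha>\<^sup>2 * r\<^sup>2 * (1 + m i * (m i + 1)) + (\<beta> + h * \<alpha>) * (m i * (m i + 1))
          - (\<omega> + h * h * \<delta>\<^sup>2 + h * \<alpha> * \<delta> + h * \<alpha>))"
    unfolding H_def m_Suc n by algebra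
  also have "\<dots> = (2 * m i + 1) * (\<omega> - ((\<theta> i)\<^sup>2 + (B1 i)\<^sup>2
     + (\<delta> + 2) * \<theta> i * B1 i - (\<theta> i)\<^sup>2 * B1 i - \<theta> i * (B1 i)\<^sup>2 + \<theta> i * (\<beta> - \<delta>)
     - B1 i * (\<delta> + \<alpha>)))"
    unfolding H_poly_sum casimir_quadratic unfolding \<theta>_def r_def by algebra
  finally show ?thesis .
qed

lemma casimir_diag:
  "- m i * (2 * m i + 3) * G (i + 1) - (m i + 1) * (2 * m i - 1) * G i + (\<theta> i)\<^sup>2 + (B1 i)\<^sup>2
     + (\<delta> + 2) * \<theta> i * B1 i - (\<theta> i)\<^sup>2 * B1 i - \<theta> i * (B1 i)\<^sup>2 + \<theta> i * (\<beta> - \<delta>)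
     - B1 i * (\<delta> + \<alpha>) = \<omega>"
  (is "?L = \<omega>")
proof -
  have "(2 * m i + 1) * ?L = (2 * m i + 1) * \<omega>"
    using H_sum[of i] G_H[of i] G_H_Suc[of i] by algebra
  then show ?thesis using m_half'[of i] by simp
qed

text \<open>The off-diagonal factor of the Casimir element, reduced to the sum \<open>t\<close> of
  neighbouring \<theta> values and to \<open>q\<close>. As \<open>t\<close> is
  \<open>2 * (m i + 1)^2\<close>, both \<open>t * q\<close> and the sum \<open>e\<close> of squares
  simplify.\<close>

lemma casimir_off:
  "B1 i + B1 (i + 1) + h * ((\<delta> + 2) * (\<theta> i + \<theta> (i + 1)) - (\<theta> i)\<^sup>2 - (\<theta> (i + 1))\<^sup>2
     - (\<theta> i + \<theta> (i + 1)) * (B1 i + B1 (i + 1))) - (\<delta> + \<alpha>) = 0"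
proof -
  define q where "q = n i * n (i + 1) + n (i + 1) * n (i + 2)"
  have B: "B1 i + B1 (i + 1) = h * (2 * \<delta> - (\<theta> i + \<theta> (i + 1)) - \<alpha> * q)"
    unfolding B1_def[of i] B1_Suc q_def by (simp add: algebra_simps)
  have "m i * (m i + 2) * q = (m i * n i) * (n (i + 1) * (m i + 2))
      + ((m i + 2) * n (i + 2)) * (m i * n (i + 1))"
    unfolding q_def by algebra
  also have "\<dots> = 2 * ((m i + 1) * n (i + 1))"
    unfolding mn mn_Suc2 by algebra
  finally have "m i * (m i + 2) * q = 2"
    unfolding mn_Suc by simp
  moreover have "(\<theta> i + \<theta> (i + 1)) * q = 2 * (m i * (m i + 2) * q) + 2 * q"
    unfolding theta_Suc \<theta>_def[of i] by algebra
  ultimately have t1: "(\<theta> i + \<theta> (i + 1)) * q = 4 + 2 * q"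
    by simp
  define t where "t = \<theta> i + \<theta> (i + 1)"
  define e where "e = (\<theta> i)\<^sup>2 + (\<theta> (i + 1))\<^sup>2"
  \<comment> \<open>\<open>2 * e\<close> is the square of the sum plus the square of the difference
    \<open>2 * (m i + 1)\<close>, and the latter square is \<open>2 * t\<close>.\<close>
  have "2 * e = t * t + 2 * t"
    unfolding t_def e_def theta_Suc \<theta>_def[of i] by algebra
  then have e: "e = h * (t * t) + t"
    using h2 by algebra
  have "h * (2 * \<delta> - t - \<alpha> * q) + h * ((\<delta> + 2) * t - e - t * (h * (2 * \<delta> - t - \<alpha> * q))) - (\<delta> + \<alpha>) =
      (2 * h) * \<delta> - h * \<alpha> * q - (2 * h) * (h * \<delta> * t) + h * h * \<alpha> * (t * q) + h * \<delta> * t - \<delta> - \<alpha>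
      + h * (h * (t * t) + t - e)"
    by algebra
  also have "\<dots> = (2 * h) * \<delta> - h * \<alpha> * q - (2 * h) * (h * \<delta> * t) + (2 * h) * (2 * h) * \<alpha>
      + (2 * h) * (h * \<alpha> * q) + h * \<delta> * t - \<delta> - \<alpha>"
    unfolding t1[folded t_def] e by algebra
  also have "\<dots> = 0"
    unfolding h2 by algebra
  finally show ?thesis
    unfolding B t_def e_def by (simp add: algebra_simps)
qed

text \<open>Row notation: \<open>(L f) i\<close> is the value at \<open>i\<close>, so \<open>G (i + 1)\<close> is the entry in row \<open>i\<close>, column \<open>i + 1\<close>.\<close>

definition LA :: "(int \<Rightarrow> 'k) \<Rightarrow> int \<Rightarrow> 'k" where
  "LA f i = \<theta> i * f i"

definition LB :: "(int \<Rightarrow> 'k) \<Rightarrow> int \<Rightarrow> 'k" where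
  "LB f i = f (i - 1) + B1 i * f i + G (i + 1) * f (i + 1)"

definition LC :: "(int \<Rightarrow> 'k) \<Rightarrow> int \<Rightarrow> 'k" where
  "LC f i = \<delta> * f i - LA f i - LB f i"

text \<open>Half the commutator of \<open>LA\<close> and \<open>LB\<close>: the differences of
  \<open>\<theta> i\<close> with its left and right neighbours are \<open>2 * m i\<close> and
  \<open>- 2 * (m i + 1)\<close>.\<close>

definition LD :: "(int \<Rightarrow> 'k) \<Rightarrow> int \<Rightarrow> 'k" where
  "LD f i = m i * f (i - 1) - (m i + 1) * G (i + 1) * f (i + 1)"

section \<open>The relations as operator identities\<close>

lemma m_shift: "m (i - 1) = m i - 1" "m (1 + i) = m i + 1" "m (i - 2) = m i - 2" "m (i + 2) = m i + 2"
  using m_Suc[of "i - 1"] m_Suc[of "i - 2"] m_Suc[of i] m_Suc[of "i + 1"] by (simp_all add: algebra_simps)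

lemma theta_shift: "\<theta> (i - 1) = (m i - 1) * m i" "\<theta> (1 + i) = (m i + 1) * (m i + 2)"
  "\<theta> (i - 2) = (m i - 2) * (m i - 1)" "\<theta> (i + 2) = (m i + 2) * (m i + 3)"
  unfolding \<theta>_def m_shift by (simp_all add: algebra_simps)

lemma LA_LB: "LA (LB f) i - LB (LA f) i = 2 * LD f i"
  unfolding LA_def LB_def LD_def
  by (simp add: theta_shift \<theta>_def[of i] algebra_simps)

lemma alpha_op: "LA (LD f) i - LD (LA f) i + LA (LC f) i - LB (LA f) i = \<alpha> * f i"
proof -
  \<comment> \<open>The off-diagonal entries cancel identically, whatever \<open>B1\<close> and
    \<open>G\<close> are.\<close>
  have "LA (LD f) i - LD (LA f) i + LA (LC f) i - LB (LA f) i =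
      (\<delta> * \<theta> i - (\<theta> i)\<^sup>2 - 2 * \<theta> i * B1 i) * f i"
    unfolding LA_def LB_def LC_def LD_def
    by (simp add: theta_shift \<theta>_def[of i] algebra_simps power2_eq_square)
  then show ?thesis by (simp add: alpha_diag)
qed

lemma beta_op: "LB (LD f) i - LD (LB f) i + LB (LA f) i - LC (LB f) i = \<beta> * f i"
proof -
  \<comment> \<open>Entries two steps off the diagonal cancel. Those one step off are instances of
    \<open>beta_off\<close> at \<open>i\<close> and \<open>i - 1\<close>; the unsimplified index
    \<open>i - 1 + 1\<close> keeps the second one matchable.\<close>
  have "LB (LD f) i - LD (LB f) i + LB (LA f) i - LC (LB f) i =
      (G (i + 1) * (2 * m i + 3) - G i * (2 * m i - 1) + (B1 i)\<^sup>2 + 2 * \<theta> i * B1 i - \<delta> * B1 i) * f i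
      + ((m i + 2) * B1 (i + 1) - m i * B1 i + \<theta> i + \<theta> (i + 1) - \<delta>) * (G (i + 1) * f (i + 1))
      + ((m (i - 1) + 2) * B1 (i - 1 + 1) - m (i - 1) * B1 (i - 1) + \<theta> (i - 1) + \<theta> (i - 1 + 1) - \<delta>)
        * f (i - 1)"
    unfolding LA_def LB_def LC_def LD_def
    by (simp add: m_shift theta_shift \<theta>_def[of i] algebra_simps power2_eq_square)
  then show ?thesis unfolding beta_diag beta_off by simp
qed

definition LCas :: "(int \<Rightarrow> 'k) \<Rightarrow> int \<Rightarrow> 'k" where
  "LCas f i = LD (LD f) i + LA (LA f) i + LB (LB f) i
     + h * ((\<delta> + 2) * (LA (LB f) i + LB (LA f) i) - (LA (LA (LB f)) i + LB (LA (LA f)) i)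
         - (LA (LB (LB f)) i + LB (LB (LA f)) i))
     + (\<beta> - \<delta>) * LA f i - (\<delta> + \<alpha>) * LB f i"

lemma casimir_op: "LCas f i = \<omega> * f i"
proof -
  define offd where "offd i = B1 i + B1 (i + 1)
     + h * ((\<delta> + 2) * (\<theta> i + \<theta> (i + 1)) - (\<theta> i)\<^sup>2 - (\<theta> (i + 1))\<^sup>2
       - (\<theta> i + \<theta> (i + 1)) * (B1 i + B1 (i + 1))) - (\<delta> + \<alpha>)" for i
  define diag where "diag = - m i * (2 * m i + 3) * G (i + 1) - (m i + 1) * (2 * m i - 1) * G i
     + (\<theta> i)\<^sup>2 + (B1 i)\<^sup>2
     + (\<delta> + 2) * \<theta> i * B1 i - (\<theta> i)\<^sup>2 * B1 i - \<theta> i * (B1 i)\<^sup>2 + \<theta> i * (\<beta> - \<delta>)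
     - B1 i * (\<delta> + \<alpha>)"
  \<comment> \<open>Doubling clears \<open>h\<close>, so the entries can be compared by plain ring
    arithmetic; 2 is cancelled at the end.\<close>
  have "2 * LCas f i = 2 * (diag * f i + offd i * (G (i + 1) * f (i + 1)) + offd (i - 1) * f (i - 1))"
  proof -
    have hx: "2 * (h * x) = x" for x
      using h2 by (simp flip: mult.assoc)
    have i: "i - 1 + 1 = i" by simp
    have offd2: "2 * offd j = 2 * (B1 j + B1 (j + 1) - (\<delta> + \<alpha>))
        + ((\<delta> + 2) * (\<theta> j + \<theta> (j + 1)) - (\<theta> j)\<^sup>2 - (\<theta> (j + 1))\<^sup>2
          - (\<theta> j + \<theta> (j + 1)) * (B1 j + B1 (j + 1)))" for j
      unfolding offd_def by (simp only: distrib_left right_diff_distrib hx) simp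
    have "2 * LCas f i = 2 * (LD (LD f) i + LA (LA f) i + LB (LB f) i
          + (\<beta> - \<delta>) * LA f i - (\<delta> + \<alpha>) * LB f i)
        + ((\<delta> + 2) * (LA (LB f) i + LB (LA f) i) - (LA (LA (LB f)) i + LB (LA (LA f)) i)
           - (LA (LB (LB f)) i + LB (LB (LA f)) i))"
      unfolding LCas_def by (simp only: distrib_left right_diff_distrib hx) simp
    also have "\<dots> = 2 * diag * f i + 2 * offd i * (G (i + 1) * f (i + 1))
        + 2 * offd (i - 1) * f (i - 1)"
      unfolding offd2 i diag_def LA_def LB_def LD_def
      by (simp add: m_shift theta_shift \<theta>_def[of i] algebra_simps power2_eq_square)
    finally show ?thesis by (simp add: algebra_simps)
  qed
  moreover have "offd i = 0" for i
    unfolding offd_def by (rule casimir_off)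
  moreover have "diag = \<omega>"
    unfolding diag_def by (rule casimir_diag)
  ultimately show ?thesis using two by simp
qed

lemma LB_LC: "LB (LC f) i = \<delta> * LB f i - LB (LA f) i - LB (LB f) i"
  by (simp add: LB_def LC_def algebra_simps)

lemma LD_LC: "LD (LC f) i = \<delta> * LD f i - LD (LA f) i - LD (LB f) i"
  by (simp add: LD_def LC_def algebra_simps)

text \<open>As \<open>LC\<close> is \<delta> minus \<open>LA\<close> minus \<open>LB\<close>, this
  relation is minus the sum of those for \<alpha> and \<beta>.\<close>

lemma gamma_op: "LC (LD f) i - LD (LC f) i + LC (LB f) i - LA (LC f) i = (- \<alpha> - \<beta>) * f i"
proof -
  have LA_LC: "LA (LC f) i = \<delta> * LA f i - LA (LA f) i - LA (LB f) i"
    by (simp add: LA_def LC_def algebra_simps)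
  have "LC (LD f) i - LD (LC f) i + LC (LB f) i - LA (LC f) i =
     - (LA (LD f) i - LD (LA f) i + LA (LC f) i - LB (LA f) i)
     - (LB (LD f) i - LD (LB f) i + LB (LA f) i - LC (LB f) i)"
    unfolding LD_LC LA_LC unfolding LC_def by (simp add: algebra_simps)
  then show ?thesis
    unfolding alpha_op beta_op by (simp add: algebra_simps)
qed

section \<open>The resulting module, and elements that act as scalars\<close>

definition LT :: "racah_gen \<Rightarrow> (int \<Rightarrow> 'k) \<Rightarrow> int \<Rightarrow> 'k" where
  "LT g = (case g of Gen_A \<Rightarrow> LA | Gen_B \<Rightarrow> LB | Gen_C \<Rightarrow> LC | Gen_D \<Rightarrow> LD)"

lemma LT_add: "LT g (u + v) = LT g u + LT g v"
  by (cases g) (simp_all add: LT_def fun_eq_iff LA_def LB_def LC_def LD_def algebra_simps)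

text \<open>Linearity over all of \<open>'k\<close>, not just over the image of \<iota>: the central
  scalars lie in \<open>'k\<close>.\<close>

lemma LT_smult: "LT g (\<lambda>i. k * v i) = (\<lambda>i. k * LT g v i)"
  by (cases g) (simp_all add: LT_def fun_eq_iff LA_def LB_def LC_def LD_def algebra_simps)

lemma alpha_op': "LA (LD f) - LD (LA f) + LA (LC f) - LB (LA f) = (\<lambda>i. \<alpha> * f i)"
  by (simp add: fun_eq_iff alpha_op)

lemma beta_op': "LB (LD f) - LD (LB f) + LB (LA f) - LC (LB f) = (\<lambda>i. \<beta> * f i)"
  by (simp add: fun_eq_iff beta_op)

lemma gamma_op': "LC (LD f) - LD (LC f) + LC (LB f) - LA (LC f) = (\<lambda>i. (- \<alpha> - \<beta>) * f i)"
  by (simp add: fun_eq_iff gamma_op)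

sublocale rep: racah_module "\<lambda>c f i. \<iota> c * f i" LT LA LB LC LD
proof unfold_locales
  show "LT Gen_A = LA" "LT Gen_B = LB" "LT Gen_C = LC" "LT Gen_D = LD"
    by (simp_all add: LT_def)
  fix v
  have AB: "LA (LB v) i - LB (LA v) i = LD v i + LD v i" for i
    by (simp add: LA_LB)
  then show "LA (LB v) - LB (LA v) = LD v + LD v"
    by (simp add: fun_eq_iff)
  have "LB (LC v) i - LC (LB v) i = LD v i + LD v i"
    "LC (LA v) i - LA (LC v) i = LD v i + LD v i" for i
    unfolding LB_LC AB[symmetric] by (simp_all add: LC_def LA_def[of "LC v"] algebra_simps LA_def)
  then show "LB (LC v) - LC (LB v) = LD v + LD v" "LC (LA v) - LA (LC v) = LD v + LD v"
    by (simp_all add: fun_eq_iff)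
  show "LT g (u + w) = LT g u + LT g w" "LT g (\<lambda>i. \<iota> c * u i) = (\<lambda>i. \<iota> c * LT g u i)" for g u w c
    by (fact LT_add LT_smult)+
  \<comment> \<open>Each bracket is multiplication by a scalar, and so commutes with the linear
    operator \<open>LT g\<close>.\<close>
  show "LA (LD (LT g v)) - LD (LA (LT g v)) + LA (LC (LT g v)) - LB (LA (LT g v)) =
      LT g (LA (LD v) - LD (LA v) + LA (LC v) - LB (LA v))"
    "LB (LD (LT g v)) - LD (LB (LT g v)) + LB (LA (LT g v)) - LC (LB (LT g v)) =
      LT g (LB (LD v) - LD (LB v) + LB (LA v) - LC (LB v))"
    "LC (LD (LT g v)) - LD (LC (LT g v)) + LC (LB (LT g v)) - LA (LC (LT g v)) =
      LT g (LC (LD v) - LD (LC v) + LC (LB v) - LA (LC v))" for g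
    by (simp_all only: alpha_op' beta_op' gamma_op' LT_smult)
qed (use \<iota> in \<open>simp_all add: fun_eq_iff ring_morphism_def algebra_simps\<close>)

text \<open>A relation and not a function, since a general element does not act as a scalar.\<close>

definition acts :: "'f racah \<Rightarrow> 'k \<Rightarrow> bool" where
  "acts x k \<longleftrightarrow> (\<forall>f. rep.racah_act x f = (\<lambda>i. k * f i))"

lemma acts_0: "acts 0 0"
  by (simp add: acts_def rep.racah_act_0 fun_eq_iff)

lemma acts_1: "acts 1 1"
  by (simp add: acts_def rep.racah_act_1)

lemma acts_add: "acts x k \<Longrightarrow> acts y l \<Longrightarrow> acts (x + y) (k + l)"
  by (simp add: acts_def rep.racah_act_add fun_eq_iff distrib_right)

lemma acts_mult: "acts x k \<Longrightarrow> acts y l \<Longrightarrow> acts (x * y) (k * l)"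
  by (simp add: acts_def rep.racah_act_mult fun_eq_iff mult.assoc)

lemma acts_scale: "acts (racah_scale c 1) (\<iota> c)"
  by (simp add: acts_def rep.racah_act_scale rep.racah_act_1)

lemma acts_0D: "acts 0 k \<Longrightarrow> k = 0"
  by (auto simp: acts_def rep.racah_act_0 fun_eq_iff dest: spec[of _ "\<lambda>_. 1"])

lemmas racah_act_simps = rep.racah_act_add rep.racah_act_diff rep.racah_act_mult
  rep.racah_act_scale rep.racah_act_gen rep.racah_act_1 rep.racah_act_2

lemma acts_alpha: "acts racah_alpha \<alpha>"
  unfolding acts_def racah_alpha_def commutator_def racah_act_simps
  by (simp add: alpha_op')

lemma acts_beta: "acts racah_beta \<beta>"
  unfolding acts_def racah_beta_def commutator_def racah_act_simps
  by (simp add: beta_op')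

lemma acts_delta: "acts racah_delta \<delta>"
  unfolding acts_def racah_delta_def racah_act_simps
  by (simp add: fun_eq_iff LC_def)

lemma acts_sum:
  assumes "\<And>i. i \<in> I \<Longrightarrow> acts (x i) (k i)"
  shows "acts (sum x I) (sum k I)"
  using assms by (induction I rule: infinite_finite_induct) (simp_all add: acts_0 acts_add)

lemma acts_power: "acts x k \<Longrightarrow> acts (x ^ j) (k ^ j)"
  by (induction j) (simp_all add: acts_1 acts_mult)

lemma acts_casimir:
  "acts (racah_D^2 + racah_A^2 + racah_B^2
     + racah_scale (1 / 2) ((racah_delta + 2) * anticommutator racah_A racah_B
         - anticommutator (racah_A^2) racah_B - anticommutator racah_A (racah_B^2))
     + racah_A * (racah_beta - racah_delta) - racah_B * (racah_delta + racah_alpha)) \<omega>"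
proof -
  have d: "rep.racah_act racah_alpha f = (\<lambda>i. \<alpha> * f i)" "rep.racah_act racah_beta f = (\<lambda>i. \<beta> * f i)"
    "rep.racah_act racah_delta f = (\<lambda>i. \<delta> * f i)" for f
    using acts_alpha acts_beta acts_delta by (simp_all add: acts_def)
  have comb: "LA ((\<lambda>i. \<beta> * f i) - (\<lambda>i. \<delta> * f i)) i = (\<beta> - \<delta>) * LA f i"
    "LB ((\<lambda>i. \<delta> * f i) + (\<lambda>i. \<alpha> * f i)) i = (\<delta> + \<alpha>) * LB f i" for f i
    by (simp_all add: LA_def LB_def algebra_simps)
  \<comment> \<open>The coefficient 1/2 lies in \<open>'f\<close> but \<open>h\<close> lies in
    \<open>'k\<close>; since \<iota> fixes 2, it sends one to the other.\<close>
  have \<iota>2: "\<iota> 2 = 2"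
    using \<iota> unfolding ring_morphism_def one_add_one[symmetric] by metis
  with two \<iota> have "(2 :: 'f) \<noteq> 0"
    unfolding ring_morphism_def by metis
  then have "\<iota> (1 / 2 * 2) = 1"
    using \<iota> by (simp add: ring_morphism_def)
  then have "\<iota> (1 / 2) * \<iota> 2 = 1"
    using \<iota> unfolding ring_morphism_def by metis
  then have "\<iota> (1 / 2) = h"
    using h2 two unfolding \<iota>2 by (metis mult.commute mult_cancel_left)
  then show ?thesis
    unfolding acts_def anticommutator_def power2_eq_square racah_act_simps d
    by (simp add: fun_eq_iff casimir_op[symmetric] LCas_def comb distrib_right)
qed

end

section \<open>The subalgebra generated by the central elements\<close>

definition racah_const :: "'f::field \<Rightarrow> 'f racah" where
  "racah_const c = racah_scale c 1"

lemma ring_morphism_racah_const: "ring_morphism racah_const"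
proof -
  interpret vector_space "racah_scale :: 'a \<Rightarrow> _" by (rule vector_space_racah_scale)
  show ?thesis
    by (simp add: ring_morphism_def racah_const_def scale_left_distrib racah_scale_mult_left)
qed

lemma racah_scale_conv: "racah_scale c x = racah_const c * x"
  by (simp add: racah_const_def racah_scale_mult_left)

lemma racah_const_commute: "racah_const c * x = x * racah_const c"
  by (simp add: racah_const_def racah_scale_mult_left racah_scale_mult_right)

lemma racah_double_eq_0:
  fixes x :: "'f::field racah"
  assumes "(2 :: 'f) \<noteq> 0" "2 * x = 0"
  shows "x = 0"
proof -
  interpret vector_space "racah_scale :: 'f \<Rightarrow> _" by (rule vector_space_racah_scale)
  have "x = racah_scale (1 / 2 * 2) x"
    using assms(1) by simp
  also have "\<dots> = racah_scale (1 / 2) (racah_scale (1 + 1) x)"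
    by simp
  also have "racah_scale (1 + 1) x = 2 * x"
    by (simp only: scale_left_distrib scale_one mult_2)
  finally show ?thesis by (simp add: assms(2))
qed

text \<open>In the commutator of either generator with \<delta>, the two contributions 2D
  cancel.\<close>

lemma racah_delta_commute:
  "racah_A * racah_delta = racah_delta * (racah_A :: 'f::field racah)"
  "racah_B * racah_delta = racah_delta * (racah_B :: 'f::field racah)"
  using racah_relations[where 'f='f]
  by (simp_all add: racah_delta_def commutator_def algebra_simps)

text \<open>The products in \<alpha> + \<beta> + \<gamma> cancel and leave [\<delta>, D]. This
  vanishes, since \<delta> commutes with AB and BA, hence with 2D, and 2 is invertible.\<close>

lemma racah_gamma_conv:
  assumes "(2 :: 'f::field) \<noteq> 0"
  shows "racah_gamma = - racah_alpha - (racah_beta :: 'f racah)"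
proof -
  let ?\<delta> = "racah_delta :: 'f racah" and ?A = "racah_A :: 'f racah" and ?B = "racah_B :: 'f racah"
  have D: "2 * racah_D = ?A * ?B - ?B * ?A"
    using racah_relations(1)[where 'f='f] by (simp add: commutator_def)
  have "?A * ?B * ?\<delta> = ?\<delta> * (?A * ?B)" "?B * ?A * ?\<delta> = ?\<delta> * (?B * ?A)"
    by (simp_all add: mult.assoc racah_delta_commute) (simp_all add: racah_delta_commute flip: mult.assoc)
  then have "2 * racah_D * ?\<delta> = ?\<delta> * (2 * racah_D)"
    unfolding D by (simp add: algebra_simps)
  then have "2 * (?\<delta> * racah_D - racah_D * ?\<delta>) = 0"
    by (simp add: mult_2 mult_2_right algebra_simps)
  then have "?\<delta> * racah_D - racah_D * ?\<delta> = 0"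
    by (rule racah_double_eq_0[OF assms])
  then show ?thesis
    by (simp add: racah_alpha_def racah_beta_def racah_gamma_def racah_delta_def commutator_def
      algebra_simps)
qed

text \<open>Nested polynomials encode three variables: \<open>x\<close> replaces the innermost one,
  \<open>z\<close> the outermost.\<close>

definition eval3 :: "('f::field \<Rightarrow> 'r::ring_1) \<Rightarrow> 'r \<Rightarrow> 'r \<Rightarrow> 'r \<Rightarrow> 'f poly poly poly \<Rightarrow> 'r" where
  "eval3 \<phi> x y z = poly_ext (poly_ext (poly_ext \<phi> x) y) z"

abbreviation racah_eval :: "'f::field poly poly poly \<Rightarrow> 'f racah" where
  "racah_eval \<equiv> eval3 racah_const racah_alpha racah_beta racah_delta"

lemma ring_morphism_0: "ring_morphism \<phi> \<Longrightarrow> \<phi> 0 = 0"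
  by (simp add: ring_morphism_def)

text \<open>The element \<delta>, adjoined last, commutes with all polynomials in \<alpha> and
  \<beta> because these two are central.\<close>

lemma ring_morphism_racah_eval: "ring_morphism racah_eval"
proof -
  have 1: "ring_morphism (poly_ext racah_const racah_alpha)"
    by (intro ring_morphism_poly_ext ring_morphism_racah_const racah_const_commute)
  have 2: "ring_morphism (poly_ext (poly_ext racah_const racah_alpha) racah_beta)"
    by (intro ring_morphism_poly_ext 1 racah_central(2)[symmetric])
  show ?thesis
    unfolding eval3_def
    by (intro ring_morphism_poly_ext 2 poly_ext_commute ring_morphism_0 1
        ring_morphism_racah_const racah_const_commute racah_central)
qed

lemma racah_eval_gens:
  "racah_eval [:[:[:c:]:]:] = racah_const (c :: 'f::field)"
  "racah_eval [:[:[:0, 1:]:]:] = (racah_alpha :: 'f racah)"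
  "racah_eval [:[:0, 1:]:] = (racah_beta :: 'f racah)"
  "racah_eval [:0, 1:] = (racah_delta :: 'f racah)"
proof -
  have "racah_const (0 :: 'f) = 0" "racah_const (1 :: 'f) = 1"
    using ring_morphism_racah_const[where 'a='f] by (simp_all add: ring_morphism_def)
  then show "racah_eval [:[:[:c:]:]:] = racah_const c" "racah_eval [:[:[:0, 1:]:]:] = (racah_alpha :: 'f racah)"
    "racah_eval [:[:0, 1:]:] = (racah_beta :: 'f racah)" "racah_eval [:0, 1:] = (racah_delta :: 'f racah)"
    by (simp_all add: eval3_def poly_ext_pCons one_pCons)
qed

text \<open>The range is a subalgebra containing the generators, \<gamma> being minus the sum of
  \<alpha> and \<beta>.\<close>

lemma racah_frakC_subset:
  assumes "(2 :: 'f::field) \<noteq> 0"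
  shows "(racah_frakC :: 'f racah set) \<subseteq> range racah_eval"
  unfolding racah_frakC_def
proof (rule hull_minimal)
  have hom: "racah_eval 1 = (1 :: 'f racah)"
    "racah_eval p + racah_eval q = (racah_eval (p + q) :: 'f racah)"
    "racah_eval p * racah_eval q = (racah_eval (p * q) :: 'f racah)" for p q
    using ring_morphism_racah_eval[where 'a='f] by (simp_all add: ring_morphism_def)
  have add: "x + y \<in> range racah_eval" and mult: "x * y \<in> range racah_eval"
    if "x \<in> range racah_eval" "y \<in> range racah_eval" for x y :: "'f racah"
    using that by (auto simp: hom)
  have const: "racah_const c \<in> range racah_eval" for c :: 'f
    by (metis racah_eval_gens(1) rangeI)
  have gens: "racah_alpha \<in> range racah_eval" "racah_beta \<in> range racah_eval"
    "(racah_delta :: 'f racah) \<in> range racah_eval"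
    by (metis racah_eval_gens rangeI)+
  have "racah_gamma = racah_const (- 1) * (racah_alpha + (racah_beta :: 'f racah))"
  proof -
    interpret vector_space "racah_scale :: 'f \<Rightarrow> _" by (rule vector_space_racah_scale)
    show ?thesis
      unfolding racah_scale_conv[symmetric] by (simp add: racah_gamma_conv[OF assms])
  qed
  then have "(racah_gamma :: 'f racah) \<in> range racah_eval"
    by (metis add mult const gens(1,2))
  with gens show "{racah_alpha, racah_beta, racah_gamma, racah_delta} \<subseteq> range (racah_eval :: _ \<Rightarrow> 'f racah)"
    by simp
  show "racah_subalgebra (range (racah_eval :: _ \<Rightarrow> 'f racah))"
    unfolding racah_subalgebra_def
    using rangeI[of racah_eval "1 :: 'f poly poly poly"] by (simp add: hom(1) add mult const racah_scale_conv)
qed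

text \<open>Follow one nonzero coefficient down to the field, then choose the values from the
  innermost variable outwards, avoiding finitely many roots each time.\<close>

lemma ex_eval3_nonzero:
  fixes \<phi> :: "'f::field \<Rightarrow> 'k::field"
  assumes "infinite (UNIV :: 'k set)" "ring_morphism \<phi>" "inj \<phi>" "q \<noteq> 0"
  shows "\<exists>x y z. eval3 \<phi> x y z q \<noteq> 0"
proof -
  have 0: "\<phi> 0 = 0" using assms(2) by (rule ring_morphism_0)
  obtain k where k: "coeff q k \<noteq> 0"
    using assms(4) by (metis leading_coeff_0_iff)
  obtain j where j: "coeff (coeff q k) j \<noteq> 0"
    using k by (metis leading_coeff_0_iff)
  obtain i where i: "coeff (coeff (coeff q k) j) i \<noteq> 0"
    using j by (metis leading_coeff_0_iff)
  from i 0 \<open>inj \<phi>\<close> have "\<phi> (coeff (coeff (coeff q k) j) i) \<noteq> 0"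
    by (metis injD)
  then obtain x where "poly_ext \<phi> x (coeff (coeff q k) j) \<noteq> 0"
    using ex_poly_ext_nonzero[OF assms(1), of \<phi>] 0 by blast
  then obtain y where "poly_ext (poly_ext \<phi> x) y (coeff q k) \<noteq> 0"
    using ex_poly_ext_nonzero[OF assms(1), of "poly_ext \<phi> x"] poly_ext_0 by blast
  then show ?thesis
    unfolding eval3_def using ex_poly_ext_nonzero[OF assms(1), of "poly_ext (poly_ext \<phi> x) y"] poly_ext_0 by blast
qed

lemma (in racah_lattice) acts_racah_eval: "acts (racah_eval q) (eval3 \<iota> \<alpha> \<beta> \<delta> q)"
  unfolding eval3_def
  by (intro poly_ext_related[where P = acts] acts_0 acts_add acts_mult poly_ext_0
      acts_alpha acts_beta acts_delta acts_scale[folded racah_const_def]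
      ring_morphism_0 ring_morphism_racah_const \<iota>)

section \<open>Algebraic independence\<close>

abbreviation fract_const :: "'f::field \<Rightarrow> 'f poly fract" where
  "fract_const c \<equiv> to_fract [:c:]"

lemma ring_morphism_fract_const: "ring_morphism (fract_const :: 'f::field \<Rightarrow> _)"
  by (auto simp: ring_morphism_def simp flip: to_fract_add to_fract_mult one_pCons)

lemma inj_fract_const: "inj fract_const"
  by (intro injI) simp

lemma infinite_UNIV_poly_fract: "infinite (UNIV :: 'f::field poly fract set)"
proof -
  have "inj (\<lambda>i. to_fract (monom (1 :: 'f) i))"
    by (intro injI) (simp add: monom_eq_iff')
  then show ?thesis
    using finite_subset[OF subset_UNIV] range_inj_infinite by blast
qed

text \<open>Here \<open>m i\<close> is X + i. The denominators have X-coefficient 1 or 2, so they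
  are nonzero even where i vanishes modulo the characteristic. The conditions do not involve
  \<alpha>, \<beta>, \<delta>, \<omega>, which stay free.\<close>

lemma racah_lattice_poly_fract:
  assumes "(2 :: 'f::field) \<noteq> 0"
  shows "racah_lattice (fract_const :: 'f \<Rightarrow> _) (\<lambda>i. to_fract [:of_int i, 1:])"
proof
  show "ring_morphism (fract_const :: 'f \<Rightarrow> _)" by (rule ring_morphism_fract_const)
  have 1: "(1 :: 'f poly fract) = to_fract [:1:]" by (simp flip: one_pCons)
  have 2: "(2 :: 'f poly fract) = to_fract [:2:]"
    unfolding one_add_one[symmetric] 1 by (simp flip: to_fract_add)
  show "(2 :: 'f poly fract) \<noteq> 0"
    unfolding 2 using assms by simp
  fix i :: int
  show "to_fract [:of_int (i + 1), 1:] = to_fract [:of_int i, 1:] + (1 :: 'f poly fract)"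
    unfolding 1 by (simp flip: to_fract_add)
  show "to_fract [:of_int i, 1:] \<noteq> (0 :: 'f poly fract)"
    by simp
  show "2 * to_fract [:of_int i, 1:] - 1 \<noteq> (0 :: 'f poly fract)"
    unfolding 1 2 using assms by (simp flip: to_fract_mult to_fract_diff)
qed

theorem lemma7p7:
  fixes \<Omega> :: "'f::field racah"
  assumes "CHAR('f) \<noteq> 2"
    and "\<Omega> \<in> casimir_class"
  shows "alg_independent_over racah_frakC \<Omega>"
  unfolding alg_independent_over_def
proof (intro allI impI)
  fix p :: "'f racah poly"
  assume p: "(\<forall>i. coeff p i \<in> racah_frakC) \<and> p \<noteq> 0"
  have "CHAR('f) \<noteq> 1"
    using CHAR_not_1[where 'a='f] by simp
  with assms(1) have "\<not> CHAR('f) dvd 2"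
    using prime_nat_iff two_is_prime_nat by blast
  then have two: "(2 :: 'f) \<noteq> 0"
    using of_nat_eq_0_iff_char_dvd[of 2, where 'a='f] by simp
  from p racah_frakC_subset[OF two] have "\<forall>i. \<exists>q. coeff p i = racah_eval q"
    by blast
  then obtain Q where Q: "coeff p i = racah_eval (Q i)" for i
    by metis
  let ?e = "eval3 (fract_const :: 'f \<Rightarrow> _)"
  have "Q (degree p) \<noteq> 0"
  proof
    assume "Q (degree p) = 0"
    then have "lead_coeff p = 0"
      unfolding Q using ring_morphism_0[OF ring_morphism_racah_eval] by simp
    with p show False by simp
  qed
  \<comment> \<open>The three scalars are chosen to keep the leading coefficient of \<open>p\<close>
    nonzero; \<open>q\<close> is then the image of \<open>p\<close> over the field of
    fractions.\<close>
  then obtain \<alpha> \<beta> \<delta> where nz: "?e \<alpha> \<beta> \<delta> (Q (degree p)) \<noteq> 0"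
    using ex_eval3_nonzero[OF infinite_UNIV_poly_fract ring_morphism_fract_const inj_fract_const]
    by blast
  define q where "q = (\<Sum>i\<le>degree p. monom (?e \<alpha> \<beta> \<delta> (Q i)) i)"
  have "coeff q (degree p) = ?e \<alpha> \<beta> \<delta> (Q (degree p))"
    by (simp add: q_def coeff_sum)
  with nz have "q \<noteq> 0" by auto
  then have "finite {y. poly q y = 0}" by (rule poly_roots_finite)
  then obtain y where y: "poly q y \<noteq> 0"
    using ex_new_if_finite[OF infinite_UNIV_poly_fract] by blast
  obtain c where \<Omega>: "\<Omega> = racah_D^2 + racah_A^2 + racah_B^2
     + racah_scale (1 / 2) ((racah_delta + 2) * anticommutator racah_A racah_B
         - anticommutator (racah_A^2) racah_B - anticommutator racah_A (racah_B^2))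
     + racah_A * (racah_beta - racah_delta) - racah_B * (racah_delta + racah_alpha) + c"
    and "c \<in> racah_frakC"
    using assms(2) by (auto simp: casimir_class_def Let_def)
  then obtain r where r: "c = racah_eval r"
    using racah_frakC_subset[OF two] by blast
  \<comment> \<open>The element \<open>c\<close> of the coset acts as
    \<open>?e \<alpha> \<beta> \<delta> r\<close>. Subtracting this from the Casimir value makes
    \<Omega> act as \<open>y\<close>, which is not a root of \<open>q\<close>.\<close>
  interpret racah_lattice "fract_const :: 'f \<Rightarrow> _" "\<lambda>i. to_fract [:of_int i, 1:]"
    \<alpha> \<beta> \<delta> "y - ?e \<alpha> \<beta> \<delta> r"
    by (rule racah_lattice_poly_fract[OF two])
  have "acts \<Omega> (y - ?e \<alpha> \<beta> \<delta> r + ?e \<alpha> \<beta> \<delta> r)"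
    unfolding \<Omega> r by (intro acts_add acts_casimir acts_racah_eval)
  then have "acts \<Omega> y" by simp
  then have "acts (\<Sum>i\<le>degree p. coeff p i * \<Omega> ^ i) (\<Sum>i\<le>degree p. ?e \<alpha> \<beta> \<delta> (Q i) * y ^ i)"
    unfolding Q by (intro acts_sum acts_mult acts_power acts_racah_eval)
  moreover have "(\<Sum>i\<le>degree p. ?e \<alpha> \<beta> \<delta> (Q i) * y ^ i) = poly q y"
    by (simp add: q_def poly_sum poly_monom)
  ultimately show "(\<Sum>i\<le>degree p. coeff p i * \<Omega> ^ i) \<noteq> 0"
    using y acts_0D by auto
qed

end
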